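(* For every $n\geq 1$, the polynomial $qr\,C_{n,213}(p,q,r)$ is symmetric in the variables $p,q,r$. Furthermore, for integers $m,d,k\ge 0$, the number of Stirling permutations in $\mathcal{Q}_n(213)$ with exactly $m$ ascents, $d$ descents and $k$ plateaus equals $$\frac{1}{n}\binom{n}{m+1}\binom{n}{d+1}\binom{n}{k}\quad\text{if } 2n-1=m+d+k,$$ and equals $0$ otherwise. Moreover, $$\sum_{\sigma\in \mathcal{Q}_n(213)}p^{\mathrm{plat}(\sigma)}=\frac{1}{n}\sum_{i=0}^{n-1}\binom{n}{i}\binom{2n}{n-1-i}p^{n-i}.$$
   Context: A Stirling permutation of order $n$ is a permutation $\sigma=\sigma_1\cdots\sigma_{2n}$ of the multiset $\{1,1,2,2,\ldots,n,n\}$ such that, for each $i\in[n]$, every entry between the two occurrences of $i$ is greater than $i$; $\mathcal{Q}_n$ denotes the set of these. For $\sigma\in\mathcal{Q}_n$: $\mathrm{des}(\sigma)=\#\{i: 1\le i\le 2n-1,\ \sigma_i>\sigma_{i+1}\}$, $\mathrm{asc}(\sigma)=\#\{i: 1\le i\le 2n-1,\ \sigma_i<\sigma_{i+1}\}$, $\mathrm{plat}(\sigma)=\#\{i: 1\le i\le 2n-1,\ \sigma_i=\sigma_{i+1}\}$. A Stirling permutation $\sigma\in\mathcal{Q}_n$ contains a pattern $\tau=\tau_1\cdots\tau_k$ if there are indices $1\le i_1<\cdots<i_k\le 2n$ with $\sigma_{i_s}<\sigma_{i_t}$ whenever $\tau_s<\tau_t$ (so for a permutation pattern like $213$, this means a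 subsequence $\sigma_{i_1}\sigma_{i_2}\sigma_{i_3}$ with $\sigma_{i_2}<\sigma_{i_1}<\sigma_{i_3}$); otherwise it avoids $\tau$. $\mathcal{Q}_n(\tau)$ is the set of $\sigma\in\mathcal{Q}_n$ avoiding $\tau$, and $C_{n,\tau}(p,q,r)=\sum_{\sigma\in\mathcal{Q}_n(\tau)}p^{\mathrm{plat}(\sigma)}q^{\mathrm{des}(\sigma)}r^{\mathrm{asc}(\sigma)}$. *)

theory Defs
  imports
    "HOL-Library.Poly_Mapping"
    "HOL-Library.Multiset"
    "HOL-Combinatorics.Permutations"
    "HOL-Computational_Algebra.Polynomial"
begin

text \<open>
  A word \<open>\<sigma>\<^sub>1 \<dots> \<sigma>\<^sub>2\<^sub>n\<close> is a list, so \<open>\<sigma>\<^sub>i\<close> is \<open>\<sigma> ! (i - 1)\<close> and all positions below are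
  shifted by one.
\<close>

definition stirling_perms :: "nat \<Rightarrow> nat list set" where
  "stirling_perms n =
     {\<sigma>. mset \<sigma> = mset_set {1..n} + mset_set {1..n} \<and>
         (\<forall>a b c. a < b \<and> b < c \<and> c < length \<sigma> \<and> \<sigma> ! a = \<sigma> ! c \<longrightarrow> \<sigma> ! a < \<sigma> ! b)}"

definition des :: "nat list \<Rightarrow> nat" where
  "des \<sigma> = card {i. Suc i < length \<sigma> \<and> \<sigma> ! i > \<sigma> ! Suc i}"

definition asc :: "nat list \<Rightarrow> nat" where
  "asc \<sigma> = card {i. Suc i < length \<sigma> \<and> \<sigma> ! i < \<sigma> ! Suc i}"

definition plat :: "nat list \<Rightarrow> nat" where
  "plat \<sigma> = card {i. Suc i < length \<sigma> \<and> \<sigma> ! i = \<sigma> ! Suc i}"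

definition contains_pattern :: "nat list \<Rightarrow> nat list \<Rightarrow> bool" where
  "contains_pattern \<sigma> \<tau> \<longleftrightarrow>
     (\<exists>f :: nat \<Rightarrow> nat. strict_mono_on {..<length \<tau>} f \<and> f ` {..<length \<tau>} \<subseteq> {..<length \<sigma>} \<and>
        (\<forall>s<length \<tau>. \<forall>t<length \<tau>. \<tau> ! s < \<tau> ! t \<longrightarrow> \<sigma> ! f s < \<sigma> ! f t))"

definition stirling_avoiding :: "nat \<Rightarrow> nat list \<Rightarrow> nat list set" where
  "stirling_avoiding n \<tau> = {\<sigma> \<in> stirling_perms n. \<not> contains_pattern \<sigma> \<tau>}"

definition stirling_enum :: "nat \<Rightarrow> nat list \<Rightarrow> 'a \<Rightarrow> 'a \<Rightarrow> 'a \<Rightarrow> 'a::comm_semiring_1" where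
  "stirling_enum n \<tau> p q r = (\<Sum>\<sigma>\<in>stirling_avoiding n \<tau>. p ^ plat \<sigma> * q ^ des \<sigma> * r ^ asc \<sigma>)"

text \<open>
  Integer polynomials in indeterminates indexed by \<^typ>\<open>nat\<close>: a monomial is its finitely supported
  exponent vector, a polynomial its finitely supported family of coefficients.
\<close>

type_synonym int_mpoly = "(nat \<Rightarrow>\<^sub>0 nat) \<Rightarrow>\<^sub>0 int"

definition mvar :: "nat \<Rightarrow> int_mpoly" where
  "mvar i = Poly_Mapping.single (Poly_Mapping.single i 1) 1"

text \<open>
  Note that \<open>map_key \<pi>\<close> precomposes an exponent vector with \<open>\<pi>\<close> (and is meaningful because \<open>\<pi>\<close> is
  injective), i.e. it permutes the indeterminates of the monomial by the inverse of \<open>\<pi>\<close>.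
\<close>

definition symmetric_in :: "nat set \<Rightarrow> int_mpoly \<Rightarrow> bool" where
  "symmetric_in V f \<longleftrightarrow>
     (\<forall>\<pi>. \<pi> permutes V \<longrightarrow>
        (\<forall>m. Poly_Mapping.lookup f (Poly_Mapping.map_key \<pi> m) = Poly_Mapping.lookup f m))"

end

theory Submission
  imports Defs
begin

text \<open>
  A 213-avoiding Stirling permutation is \<open>A 1 B 1 C\<close> with all letters of \<open>A\<close> above those of \<open>B\<close> and all
  letters of \<open>B\<close> above those of \<open>C\<close>, hence it is a ternary tree with one node per letter. If \<open>i\<close>, \<open>j\<close>, \<open>k\<close>
  are the numbers of left, middle and right edges, then there are \<open>i + j\<close> descents, \<open>j + k\<close> ascents and
  \<open>n - j\<close> plateaus. The number of forests of \<open>s = n - i - j - k\<close> ternary trees with these edge numbers is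
  \<open>s/n\<close> times the product of the binomial coefficients of \<open>n\<close> over \<open>i\<close>, \<open>j\<close> and \<open>k\<close>, by induction on \<open>n\<close>,
  removing the root of the first tree. The case \<open>s = 1\<close> is the joint distribution, which is visibly
  symmetric; Vandermonde's identity gives the distribution of plateaus.
\<close>

section \<open>Counting forests of ternary trees\<close>

datatype ttree = Leaf | Node ttree ttree ttree

text \<open>Leaves are empty subtrees, not nodes: \<open>inner a\<close> is 1 exactly when an edge
  leads to the child \<open>a\<close>.\<close>

abbreviation inner :: "ttree \<Rightarrow> nat" where
  "inner t \<equiv> of_bool (t \<noteq> Leaf)"

fun lefts :: "ttree \<Rightarrow> nat" where
  "lefts Leaf = 0"
| "lefts (Node a b c) = inner a + lefts a + lefts b + lefts c"

fun mids :: "ttree \<Rightarrow> nat" where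
  "mids Leaf = 0"
| "mids (Node a b c) = inner b + mids a + mids b + mids c"

fun rights :: "ttree \<Rightarrow> nat" where
  "rights Leaf = 0"
| "rights (Node a b c) = inner c + rights a + rights b + rights c"

text \<open>The datatype \<open>size\<close> gives 0 to \<open>Leaf\<close>, so it counts nodes.
  Every node but the root is the lower end of exactly one edge; \<open>inner t\<close> accounts for
  the root.\<close>

lemma size_eq_edges: "size t = inner t + lefts t + mids t + rights t"
  by (induction t) auto

lemma finite_size_le: "finite {t :: ttree. size t \<le> n}"
proof (induction n)
  case 0
  have "{t :: ttree. size t \<le> 0} \<subseteq> {Leaf}"
    using size_eq_edges by (auto split: if_splits)
  then show ?case
    using finite_subset by blast
next
  case (Suc n)
  let ?S = "{t :: ttree. size t \<le> n}"
  have "{t :: ttree. size t \<le> Suc n} \<subseteq> insert Leaf ((\<lambda>(a, b, c). Node a b c) ` (?S \<times> ?S \<times> ?S))"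
  proof
    fix t :: ttree assume "t \<in> {t. size t \<le> Suc n}"
    then show "t \<in> insert Leaf ((\<lambda>(a, b, c). Node a b c) ` (?S \<times> ?S \<times> ?S))"
      by (cases t) force+
  qed
  then show ?case
    using Suc by (meson finite_SigmaI finite_imageI finite_insert finite_subset)
qed

definition forests :: "nat \<Rightarrow> nat \<Rightarrow> nat \<Rightarrow> nat \<Rightarrow> ttree list set" where
  "forests n i j k =
     {ts. Leaf \<notin> set ts \<and> sum_list (map size ts) = n \<and> sum_list (map lefts ts) = i \<and>
          sum_list (map mids ts) = j \<and> sum_list (map rights ts) = k}"

text \<open>Each nonempty tree has one more node than edges. The four totals thus determine the
  number of trees, so \<open>forests\<close> does not carry it as a parameter.\<close>

lemma length_forest:
  "Leaf \<notin> set ts \<Longrightarrow> sum_list (map size ts) =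
     length ts + sum_list (map lefts ts) + sum_list (map mids ts) + sum_list (map rights ts)"
  by (induction ts) (auto simp: size_eq_edges)

lemma finite_forests: "finite (forests n i j k)"
proof (rule finite_subset)
  show "forests n i j k \<subseteq> {ts. set ts \<subseteq> {t. size t \<le> n} \<and> length ts \<le> n}"
    using length_forest by (fastforce simp: forests_def intro: member_le_sum_list)
  show "finite {ts. set ts \<subseteq> {t :: ttree. size t \<le> n} \<and> length ts \<le> n}"
    by (rule finite_lists_length_le[OF finite_size_le])
qed

lemma forests_0: "forests 0 0 0 0 = {[]}"
proof -
  have "ts = []" if "ts \<in> forests 0 0 0 0" for ts
    using that length_forest[of ts] unfolding forests_def by (simp del: sum_list_eq_0_iff)
  then show ?thesis
    by (auto simp: forests_def)
qed

text \<open>With at least one node there is at least one root, hence fewer edges than nodes.\<close>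

lemma forests_eq_empty:
  assumes "n \<ge> 1" "i + j + k \<ge> n"
  shows "forests n i j k = {}"
proof -
  have False if "ts \<in> forests n i j k" for ts
    using that length_forest[of ts] assms by (auto simp: forests_def)
  then show ?thesis by blast
qed

text \<open>
  The children of the removed root replace it in the forest; the three bits record which of them
  are not leaves, which makes the map injective.
\<close>

fun remove_root :: "ttree list \<Rightarrow> (nat \<times> nat \<times> nat) \<times> ttree list" where
  "remove_root (Node a b c # ts) =
     ((inner a, inner b, inner c), filter (\<lambda>t. t \<noteq> Leaf) [a, b, c] @ ts)"
| "remove_root ts = ((0, 0, 0), ts)"

lemma forests_Suc_ne:
  assumes "ts \<in> forests (Suc n) i j k"
  obtains a b c us where "ts = Node a b c # us"
proof (cases ts)
  case (Cons t us)
  then show ?thesis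
    using assms that by (cases t) (auto simp: forests_def)
qed (use assms in \<open>auto simp: forests_def\<close>)

text \<open>The possible values of one bit of \<open>remove_root\<close>; the bound by
  \<open>i\<close> keeps the later subtraction \<open>i - a\<close> exact.\<close>

definition slots :: "nat \<Rightarrow> nat set" where
  "slots i = {a. a \<le> 1 \<and> a \<le> i}"

text \<open>\<open>remove_root\<close> is a bijection onto the pairs of possible bits and smaller
  forests. The assumption leaves at least \<open>a + b + c\<close> trees in the smaller forest,
  enough to supply the children of a new root.\<close>

lemma card_forests_Suc:
  assumes "i + j + k \<le> n"
  shows "card (forests (Suc n) i j k) =
    (\<Sum>a\<in>slots i. \<Sum>b\<in>slots j. \<Sum>c\<in>slots k. card (forests n (i - a) (j - b) (k - c)))"
proof -
  define T where "T = (SIGMA (a, b, c):slots i \<times> slots j \<times> slots k. forests n (i - a) (j - b) (k - c))"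
  have "bij_betw remove_root (forests (Suc n) i j k) T"
  proof (rule bij_betw_imageI)
    show "inj_on remove_root (forests (Suc n) i j k)"
    proof (rule inj_onI)
      fix ts us assume *: "ts \<in> forests (Suc n) i j k" "us \<in> forests (Suc n) i j k"
        "remove_root ts = remove_root us"
      obtain a b c ts' where "ts = Node a b c # ts'" using forests_Suc_ne * by metis
      moreover obtain a' b' c' us' where "us = Node a' b' c' # us'" using forests_Suc_ne * by metis
      ultimately show "ts = us"
        using *(3) by (auto split: if_splits)
    qed
    show "remove_root ` forests (Suc n) i j k = T"
    proof (intro equalityI subsetI)
      fix y assume "y \<in> remove_root ` forests (Suc n) i j k"
      then obtain a b c ts where "Node a b c # ts \<in> forests (Suc n) i j k"
        "y = remove_root (Node a b c # ts)"
        by (metis (no_types, lifting) forests_Suc_ne imageE)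
      then show "y \<in> T"
        by (auto simp: T_def forests_def slots_def)
    next
      fix y assume "y \<in> T"
      then obtain a b c ts where y: "y = ((a, b, c), ts)" and abc: "a \<in> slots i" "b \<in> slots j" "c \<in> slots k"
        and ts: "ts \<in> forests n (i - a) (j - b) (k - c)"
        by (auto simp: T_def)
      have len: "length ts \<ge> a + b + c"
        using length_forest[of ts] ts abc assms by (auto simp: forests_def slots_def)
      \<comment> \<open>\<open>f\<close> inverts \<open>remove_root\<close> one child at a time: bit
        0 gives a leaf, bit 1 takes the first remaining tree.\<close>
      define f where "f v vs = (if v = (0::nat) then (Leaf, vs) else (hd vs, tl vs))" for v vs
      obtain l ts1 where 1: "f a ts = (l, ts1)" by (cases "f a ts")
      obtain m ts2 where 2: "f b ts1 = (m, ts2)" by (cases "f b ts1")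
      obtain r ts3 where 3: "f c ts2 = (r, ts3)" by (cases "f c ts2")
      have f: "inner l = v \<and> us = filter (\<lambda>t. t \<noteq> Leaf) [l] @ us' \<and> length us' = length us - v"
        if "f v us = (l, us')" "v \<le> 1" "v \<le> length us" "Leaf \<notin> set us" for v us l us'
        using that by (cases us) (auto simp: f_def le_Suc_eq split: if_splits)
      have le: "a \<le> 1" "b \<le> 1" "c \<le> 1" and i: "a \<le> i" "b \<le> j" "c \<le> k"
        using abc by (auto simp: slots_def)
      have nl: "Leaf \<notin> set ts"
        using ts by (auto simp: forests_def)
      have A: "inner l = a" "ts = filter (\<lambda>t. t \<noteq> Leaf) [l] @ ts1" "length ts1 = length ts - a"
        using f[OF 1 le(1) _ nl] len by (blast intro: add_leD1)+
      have nl1: "Leaf \<notin> set ts1" using nl by (subst (asm) A(2)) auto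
      have b: "b \<le> length ts1" using len A(3) by linarith
      have B: "inner m = b" "ts1 = filter (\<lambda>t. t \<noteq> Leaf) [m] @ ts2" "length ts2 = length ts1 - b"
        using f[OF 2 le(2) b nl1] by blast+
      have nl2: "Leaf \<notin> set ts2" using nl1 by (subst (asm) B(2)) auto
      have c: "c \<le> length ts2" using len A(3) B(3) by linarith
      have C: "inner r = c" "ts2 = filter (\<lambda>t. t \<noteq> Leaf) [r] @ ts3"
        using f[OF 3 le(3) c nl2] by blast+
      have "filter (\<lambda>t. t \<noteq> Leaf) [l, m, r] @ ts3 =
        filter (\<lambda>t. t \<noteq> Leaf) [l] @ filter (\<lambda>t. t \<noteq> Leaf) [m] @ filter (\<lambda>t. t \<noteq> Leaf) [r] @ ts3"
        by simp
      then have dec: "ts = filter (\<lambda>t. t \<noteq> Leaf) [l, m, r] @ ts3"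
        using A(2) B(2) C(2) by (simp only:)
      have "remove_root (Node l m r # ts3) = y"
        using A(1) B(1) C(1) dec y by simp
      moreover have "Node l m r # ts3 \<in> forests (Suc n) i j k"
        using ts i A(1) B(1) C(1) dec by (auto simp: forests_def split: if_splits)
      ultimately show "y \<in> remove_root ` forests (Suc n) i j k"
        by blast
    qed
  qed
  then have "card (forests (Suc n) i j k) = card T"
    by (rule bij_betw_same_card)
  also have "\<dots> = (\<Sum>(a, b, c)\<in>slots i \<times> slots j \<times> slots k. card (forests n (i - a) (j - b) (k - c)))"
    unfolding T_def by (subst card_SigmaI) (auto simp: finite_forests slots_def case_prod_unfold)
  finally show ?thesis
    by (simp add: sum.cartesian_product)
qed

text \<open>Pascal's rule; for \<open>i = 0\<close> the only slot is 0.\<close>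

lemma sum_slots_choose: "(\<Sum>a\<in>slots i. rat_of_nat (n choose (i - a))) = rat_of_nat (Suc n choose i)"
proof -
  have "slots i = (if i = 0 then {0} else {0, 1})" by (auto simp: slots_def)
  then show ?thesis by (cases i) auto
qed

text \<open>Only \<open>a = 1\<close> contributes, and the absorption identity rewrites its binomial
  coefficient.\<close>

lemma sum_slots_weighted_choose:
  "(\<Sum>a\<in>slots i. rat_of_nat a * rat_of_nat (n choose (i - a))) =
     rat_of_nat i / rat_of_nat (Suc n) * rat_of_nat (Suc n choose i)"
proof (cases i)
  case (Suc l)
  have "slots i = {0, 1}" using Suc by (auto simp: slots_def)
  moreover have "rat_of_nat (Suc n) * rat_of_nat (n choose l) = rat_of_nat (Suc l) * rat_of_nat (Suc n choose Suc l)"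
    by (simp only: flip: of_nat_mult) (simp only: Suc_times_binomial)
  ultimately show ?thesis
    using Suc by (simp add: field_simps del: binomial_Suc_Suc of_nat_Suc)
qed (auto simp: slots_def)

text \<open>
  Since the number of trees in the forest is linear in the edge counts, removing a root gives a linear
  recurrence (no convolution) that the closed form satisfies by Pascal's rule.
\<close>

lemma card_forests:
  assumes "n \<ge> 1" "i + j + k \<le> n"
  shows "rat_of_nat (card (forests n i j k)) =
    rat_of_nat (n - i - j - k) / rat_of_nat n *
      (rat_of_nat (n choose i) * rat_of_nat (n choose j) * rat_of_nat (n choose k))"
  using assms
proof (induction n arbitrary: i j k rule: nat_induct_at_least)
  case base
  show ?case
  proof (cases "i + j + k = 0")
    case True
    have "slots 0 = {0}" by (auto simp: slots_def)
    with True show ?thesis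
      using card_forests_Suc[of 0 0 0 0] by (simp add: forests_0)
  next
    case False
    have "forests 1 i j k = {}"
      using False by (intro forests_eq_empty) linarith+
    moreover have "1 - i - j - k = 0" using False by linarith
    ultimately show ?thesis by (simp only: card.empty of_nat_0 div_0 mult_zero_left)
  qed
next
  case (Suc n)
  show ?case
  proof (cases "i + j + k = Suc n")
    \<comment> \<open>No root is left, so both sides vanish; the recurrence requires at least one
      tree.\<close>
    case True
    have "forests (Suc n) i j k = {}"
      using True by (intro forests_eq_empty) auto
    with True show ?thesis by simp
  next
    case False
    then have le: "i + j + k \<le> n" using Suc by simp
    \<comment> \<open>\<open>s\<close> counts the trees other than the first; after the removal of
      its root there are \<open>s + a + b + c\<close> trees.\<close>
    define s where "s = rat_of_nat (n - i - j - k)"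
    define B where "B i a = rat_of_nat (n choose (i - a))" for i a
    define N where "N = rat_of_nat n"
    have N: "N > 0" using Suc by (simp add: N_def)
    have s: "s = N - rat_of_nat i - rat_of_nat j - rat_of_nat k"
      using le by (simp add: s_def N_def)
    let ?C = "\<lambda>i. rat_of_nat (Suc n choose i)"
    have B0: "(\<Sum>a\<in>slots i. B i a) = ?C i" for i
      unfolding B_def by (rule sum_slots_choose)
    have B1: "(\<Sum>a\<in>slots i. rat_of_nat a * B i a) = rat_of_nat i / (N + 1) * ?C i" for i
      unfolding B_def N_def using sum_slots_weighted_choose[of n i] by (simp add: add.commute)
    have sum3: "(\<Sum>a\<in>slots i. \<Sum>b\<in>slots j. \<Sum>c\<in>slots k. x * (f a * (g b * h c))) =
      x * (sum f (slots i) * (sum g (slots j) * sum h (slots k)))" for x :: rat and f g h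
      by (simp flip: sum_distrib_left sum_distrib_right)
    have "rat_of_nat (card (forests (Suc n) i j k)) =
      (\<Sum>a\<in>slots i. \<Sum>b\<in>slots j. \<Sum>c\<in>slots k. rat_of_nat (card (forests n (i - a) (j - b) (k - c))))"
      by (simp add: card_forests_Suc[OF le])
    also have "\<dots> = (\<Sum>a\<in>slots i. \<Sum>b\<in>slots j. \<Sum>c\<in>slots k.
        (s + rat_of_nat a + rat_of_nat b + rat_of_nat c) / N * (B i a * B j b * B k c))"
    proof (intro sum.cong refl)
      fix a b c assume *: "a \<in> slots i" "b \<in> slots j" "c \<in> slots k"
      have "n - (i - a) - (j - b) - (k - c) = (n - i - j - k) + a + b + c"
        using * le by (auto simp: slots_def)
      then have "rat_of_nat (n - (i - a) - (j - b) - (k - c)) = s + rat_of_nat a + rat_of_nat b + rat_of_nat c"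
        by (simp add: s_def)
      moreover have "(i - a) + (j - b) + (k - c) \<le> n" using le by simp
      ultimately show "rat_of_nat (card (forests n (i - a) (j - b) (k - c))) =
        (s + rat_of_nat a + rat_of_nat b + rat_of_nat c) / N * (B i a * B j b * B k c)"
        using Suc.IH[of "i - a" "j - b" "k - c"] by (simp add: B_def N_def)
    qed
    \<comment> \<open>Splitting the linear weight into four terms makes each triple sum a product of
      single sums, given by \<open>B0\<close> and \<open>B1\<close>.\<close>
    also have "\<dots> = (\<Sum>a\<in>slots i. \<Sum>b\<in>slots j. \<Sum>c\<in>slots k.
        (s / N) * (B i a * (B j b * B k c)) + 1 / N * ((rat_of_nat a * B i a) * (B j b * B k c)) +
        1 / N * (B i a * ((rat_of_nat b * B j b) * B k c)) + 1 / N * (B i a * (B j b * (rat_of_nat c * B k c))))"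
      by (intro sum.cong refl) (use N in \<open>simp add: field_simps\<close>)
    also have "\<dots> = (s / N + 1 / N * (rat_of_nat i / (N + 1)) + 1 / N * (rat_of_nat j / (N + 1))
        + 1 / N * (rat_of_nat k / (N + 1))) * (?C i * ?C j * ?C k)"
      by (simp only: sum.distrib sum3 B0 B1) (simp add: algebra_simps del: binomial_Suc_Suc)
    \<comment> \<open>As \<open>i + j + k\<close> equals \<open>N - s\<close>, the left side is
      \<open>(s * (N + 1) + N - s) / (N * (N + 1))\<close>.\<close>
    also have "s / N + 1 / N * (rat_of_nat i / (N + 1)) + 1 / N * (rat_of_nat j / (N + 1))
        + 1 / N * (rat_of_nat k / (N + 1)) = (s + 1) / (N + 1)"
    proof -
      have "N \<noteq> 0" "N + 1 \<noteq> 0" using N by auto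
      then show ?thesis by (simp add: divide_simps) (simp add: s algebra_simps)
    qed
    also have "s + 1 = rat_of_nat (Suc n - i - j - k)"
      using le by (simp add: s N_def)
    finally show ?thesis by (simp add: N_def add.commute)
  qed
qed

section \<open>Words of ternary trees\<close>

text \<open>A ternary analogue of \<open>sorted_wrt\<close>, whose recursion lets conditions on
  triples of positions split along \<open>@\<close>.\<close>

fun triple_wrt :: "('a \<Rightarrow> 'a \<Rightarrow> 'a \<Rightarrow> bool) \<Rightarrow> 'a list \<Rightarrow> bool" where
  "triple_wrt P [] \<longleftrightarrow> True"
| "triple_wrt P (x # xs) \<longleftrightarrow> sorted_wrt (P x) xs \<and> triple_wrt P xs"

lemma triple_wrt_iff_nth:
  "triple_wrt P xs \<longleftrightarrow>
     (\<forall>a b c. a < b \<and> b < c \<and> c < length xs \<longrightarrow> P (xs ! a) (xs ! b) (xs ! c))"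
proof (induction xs)
  case (Cons x xs)
  have "(\<forall>a b c. a < b \<and> b < c \<and> c < length (x # xs) \<longrightarrow> P ((x # xs) ! a) ((x # xs) ! b) ((x # xs) ! c)) \<longleftrightarrow>
    (\<forall>b c. b < c \<and> c < length xs \<longrightarrow> P x (xs ! b) (xs ! c)) \<and>
    (\<forall>a b c. a < b \<and> b < c \<and> c < length xs \<longrightarrow> P (xs ! a) (xs ! b) (xs ! c))" (is "?l \<longleftrightarrow> ?r")
  proof
    assume l: ?l
    show ?r
    proof (intro conjI allI impI)
      fix b c assume "b < c \<and> c < length xs"
      then show "P x (xs ! b) (xs ! c)" using l[rule_format, of 0 "Suc b" "Suc c"] by simp
    next
      fix a b c assume "a < b \<and> b < c \<and> c < length xs"
      then show "P (xs ! a) (xs ! b) (xs ! c)" using l[rule_format, of "Suc a" "Suc b" "Suc c"] by simp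
    qed
  next
    assume r: ?r
    show ?l
    proof (intro allI impI)
      fix a b c assume *: "a < b \<and> b < c \<and> c < length (x # xs)"
      then obtain b' c' where "b = Suc b'" "c = Suc c'"
        by (metis less_imp_Suc_add)
      then show "P ((x # xs) ! a) ((x # xs) ! b) ((x # xs) ! c)"
        using r * by (cases a) auto
    qed
  qed
  then show ?case
    using Cons by (auto simp: sorted_wrt_iff_nth_less)
qed auto

text \<open>A triple across the border has its last two entries in \<open>ys\<close> or its first
  two in \<open>xs\<close>.\<close>

lemma triple_wrt_append:
  "triple_wrt P (xs @ ys) \<longleftrightarrow> triple_wrt P xs \<and> triple_wrt P ys \<and>
     (\<forall>x\<in>set xs. sorted_wrt (P x) ys) \<and> (\<forall>z\<in>set ys. sorted_wrt (\<lambda>x y. P x y z) xs)"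
  by (induction xs) (auto simp: sorted_wrt_append)

text \<open>
  Imposed on all triples of entries in order of position, this is the Stirling condition together with
  the avoidance of 213.
\<close>

definition admissible :: "nat \<Rightarrow> nat \<Rightarrow> nat \<Rightarrow> bool" where
  "admissible u v w \<longleftrightarrow> (u = w \<longrightarrow> u < v) \<and> \<not> (v < u \<and> u < w)"

lemma contains_213_iff:
  "contains_pattern \<sigma> [2, 1, 3] \<longleftrightarrow>
     (\<exists>a b c. a < b \<and> b < c \<and> c < length \<sigma> \<and> \<sigma> ! b < \<sigma> ! a \<and> \<sigma> ! a < \<sigma> ! c)" (is "_ = ?r")
proof
  assume "contains_pattern \<sigma> [2, 1, 3]"
  then obtain f :: "nat \<Rightarrow> nat" where f: "strict_mono_on {..<3} f" "f ` {..<3} \<subseteq> {..<length \<sigma>}"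
    "\<And>s t. s < 3 \<Longrightarrow> t < 3 \<Longrightarrow> [2, 1, 3::nat] ! s < [2, 1, 3] ! t \<Longrightarrow> \<sigma> ! f s < \<sigma> ! f t"
    by (auto simp: contains_pattern_def numeral_3_eq_3)
  have "f 0 < f 1" "f 1 < f 2"
    using f(1) by (auto simp: strict_mono_on_def)
  moreover have "f 2 < length \<sigma>" using f(2) by (simp add: image_subset_iff)
  moreover have "\<sigma> ! f 1 < \<sigma> ! f 0" "\<sigma> ! f 0 < \<sigma> ! f 2"
    using f(3)[of 1 0] f(3)[of 0 2] by auto
  ultimately show ?r by blast
next
  assume ?r
  then obtain a b c where abc: "a < b" "b < c" "c < length \<sigma>" "\<sigma> ! b < \<sigma> ! a" "\<sigma> ! a < \<sigma> ! c"
    by blast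
  have "strict_mono_on {..<3} ((!) [a, b, c])" "(!) [a, b, c] ` {..<3} \<subseteq> {..<length \<sigma>}"
    "\<forall>s<3. \<forall>t<3. [2, 1, 3::nat] ! s < [2, 1, 3] ! t \<longrightarrow> \<sigma> ! ([a, b, c] ! s) < \<sigma> ! ([a, b, c] ! t)"
    using abc by (auto simp: strict_mono_on_def less_Suc_eq numeral_3_eq_3)
  then show "contains_pattern \<sigma> [2, 1, 3]"
    unfolding contains_pattern_def by (intro exI[of _ "(!) [a, b, c]"]) (simp add: numeral_3_eq_3)
qed

text \<open>The three parts of a word use separate blocks of consecutive letters; the offset
  \<open>k\<close> lets the induction pass to such parts.\<close>

definition twice :: "nat \<Rightarrow> nat \<Rightarrow> nat multiset" where
  "twice k n = mset_set {k + 1..k + n} + mset_set {k + 1..k + n}"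

lemma twice_0 [simp]: "twice k 0 = {#}"
  by (simp add: twice_def)

lemma set_mset_twice [simp]: "set_mset (twice k n) = {k + 1..k + n}"
  by (simp add: twice_def)

lemma size_twice [simp]: "size (twice k n) = 2 * n"
  by (simp add: twice_def)

lemma twice_add: "twice k (a + b) = twice k a + twice (k + a) b"
proof -
  have "{k + 1..k + (a + b)} = {k + 1..k + a} \<union> {k + a + 1..k + a + b}" by auto
  then have "mset_set {k + 1..k + (a + b)} = mset_set {k + 1..k + a} + mset_set {k + a + 1..k + a + b}"
    by (simp add: mset_set_Union)
  then show ?thesis by (simp add: twice_def)
qed

lemma twice_Suc: "twice k (Suc n) = {#k + 1, k + 1#} + twice (k + 1) n"
  using twice_add[of k 1 n] by (simp add: twice_def)

text \<open>As \<open>y < x\<close> is strict, both copies of a letter lie on the same side, and the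
  least letter of \<open>X\<close> cuts the block in two. This turns order relations between parts
  of a word into blocks of letters.\<close>

lemma twice_split:
  assumes "X + Y = twice k n" "\<And>x y. x \<in># X \<Longrightarrow> y \<in># Y \<Longrightarrow> y < x"
  obtains a b where "n = a + b" "Y = twice k a" "X = twice (k + a) b"
proof (cases "X = {#}")
  case True
  then show ?thesis using assms that[of n 0] by simp
next
  case False
  define u where "u = Min (set_mset X)"
  have u: "u \<in># X" using False unfolding u_def by (intro Min_in) auto
  have um: "u \<le> x" if "x \<in># X" for x using that unfolding u_def by simp
  have "u \<in># twice k n" using u assms(1) by (metis union_iff)
  then have uk: "k + 1 \<le> u" "u \<le> k + n" by auto
  define a where "a = u - k - 1"
  have a: "u = k + a + 1" "a \<le> n" using uk by (auto simp: a_def)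
  have e: "twice k n = twice k a + twice (k + a) (n - a)"
    using twice_add[of k a "n - a"] a by simp
  \<comment> \<open>Keeping the letters below \<open>u\<close> leaves \<open>Y\<close> on one side
    of the equation and the lower block on the other.\<close>
  have f1: "filter_mset (\<lambda>x. x < u) X = {#}" "filter_mset (\<lambda>x. x < u) Y = Y"
    using um assms(2)[OF u] by (auto simp: filter_mset_eq_conv not_less)
  have f2: "filter_mset (\<lambda>x. x < u) (twice k a) = twice k a"
     "filter_mset (\<lambda>x. x < u) (twice (k + a) (n - a)) = {#}"
    using a by (auto simp: filter_mset_eq_conv)
  have Y: "Y = twice k a"
    using arg_cong[OF assms(1)[unfolded e], of "filter_mset (\<lambda>x. x < u)"]
    by (simp add: f1 f2)
  then have "X = twice (k + a) (n - a)" using assms(1) e by simp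
  with Y a that[of a "n - a"] show ?thesis by simp
qed

definition words :: "nat \<Rightarrow> nat \<Rightarrow> nat list set" where
  "words k n = {\<sigma>. mset \<sigma> = twice k n \<and> triple_wrt admissible \<sigma>}"

lemma stirling_avoiding_eq_words: "stirling_avoiding n [2, 1, 3] = words 0 n"
  unfolding stirling_avoiding_def stirling_perms_def words_def triple_wrt_iff_nth contains_213_iff
    twice_def admissible_def
  by auto

text \<open>
  If \<open>m\<close> is the least letter of \<open>A m B m C\<close>, avoiding 213 means that all letters of \<open>A\<close> exceed those of
  \<open>B\<close>, which exceed those of \<open>C\<close>; so the shape of the tree determines the letters.
\<close>

fun word :: "nat \<Rightarrow> ttree \<Rightarrow> nat list" where
  "word k Leaf = []"
| "word k (Node a b c) =
     word (k + 1 + size c + size b) a @ (k + 1) # word (k + 1 + size c) b @ (k + 1) # word (k + 1) c"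

lemma mset_word: "mset (word k t) = twice k (size t)"
proof (induction t arbitrary: k)
  case (Node a b c)
  \<comment> \<open>The summands stand in the order \<open>c\<close>, \<open>b\<close>,
    \<open>a\<close>, from the lowest letters upwards, to match the offsets in
    \<open>word\<close>.\<close>
  have "twice k (size (Node a b c)) = {#k + 1, k + 1#} + twice (k + 1) (size c + size b + size a)"
    by (simp add: twice_Suc add_ac)
  then show ?case
    by (simp only: twice_add) (simp add: Node add_ac)
qed simp

lemma set_word: "set (word k t) = {k + 1..k + size t}"
  using mset_word by (metis set_mset_mset set_mset_twice)

lemma length_word: "length (word k t) = 2 * size t"
  using mset_word by (metis size_mset size_twice)

lemma sorted_wrt_admissible_below:
  "sorted_wrt (admissible x) ys" if "\<forall>y\<in>set ys. x < y"
    using that by (induction ys) (auto simp: admissible_def)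

lemma sorted_wrt_admissible_above:
  "sorted_wrt (admissible x) ys" if "\<forall>y\<in>set ys. y < x"
    using that by (induction ys) (auto simp: admissible_def)

lemma sorted_wrt_admissible_last_below:
  "sorted_wrt (\<lambda>x y. admissible x y z) xs" if "\<forall>x\<in>set xs. z < x"
    using that by (induction xs) (auto simp: admissible_def)

text \<open>In a triple not contained in one part, the second entry exceeds the first, or the last
  is smaller than the first, or the first two are the two copies of \<open>m\<close>. Each of these
  is harmless.\<close>

lemma triple_wrt_admissible_glue:
  assumes "triple_wrt admissible A" "triple_wrt admissible B" "triple_wrt admissible C"
    and "\<forall>x\<in>set A. m < x" "\<forall>x\<in>set B. m < x" "\<forall>x\<in>set C. m < x"
    and "\<forall>x\<in>set A. \<forall>y\<in>set B \<union> set C. y < x" "\<forall>x\<in>set B. \<forall>y\<in>set C. y < x"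
  shows "triple_wrt admissible (A @ m # B @ m # C)"
proof -
  have "sorted_wrt (admissible m) B" "sorted_wrt (admissible m) C"
    using assms by (auto intro: sorted_wrt_admissible_below)
  moreover have "\<forall>x\<in>set A. sorted_wrt (admissible x) B \<and> sorted_wrt (admissible x) C" "\<forall>x\<in>set B. sorted_wrt (admissible x) C"
    using assms by (auto intro!: sorted_wrt_admissible_above)
  moreover have "\<forall>z\<in>insert m (set B \<union> set C). sorted_wrt (\<lambda>x y. admissible x y z) A"
    "\<forall>z\<in>insert m (set C). sorted_wrt (\<lambda>x y. admissible x y z) B"
    using assms by (auto intro!: sorted_wrt_admissible_last_below)
  moreover have "admissible u v w" if "u < v \<or> v < u \<and> w < u \<or> u = v \<and> w \<noteq> u" for u v w
    using that by (auto simp: admissible_def)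
  ultimately show ?thesis
    using assms by (auto simp: triple_wrt_append sorted_wrt_append)
qed

text \<open>Between letters of different parts stands a copy of \<open>m\<close>, smaller than both.
  With it in the middle, equal letters would violate the Stirling condition and increasing ones
  would form 213.\<close>

lemma triple_wrt_admissible_unglue:
  assumes "triple_wrt admissible (A @ m # B @ m # C)"
    and "\<forall>x\<in>set A. m < x" "\<forall>x\<in>set B. m < x" "\<forall>x\<in>set C. m < x"
  shows "triple_wrt admissible A" "triple_wrt admissible B" "triple_wrt admissible C"
    "\<forall>x\<in>set A. \<forall>y\<in>set B \<union> set C. y < x" "\<forall>x\<in>set B. \<forall>y\<in>set C. y < x"
proof -
  show "triple_wrt admissible A" "triple_wrt admissible B" "triple_wrt admissible C"
    using assms(1) by (auto simp: triple_wrt_append)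
  have "\<forall>x\<in>set A. \<forall>y\<in>set B \<union> set C. admissible x m y" "\<forall>x\<in>set B. \<forall>y\<in>set C. admissible x m y"
    using assms(1) by (auto simp: triple_wrt_append sorted_wrt_append)
  then show "\<forall>x\<in>set A. \<forall>y\<in>set B \<union> set C. y < x" "\<forall>x\<in>set B. \<forall>y\<in>set C. y < x"
    using assms(2-) unfolding admissible_def by (metis linorder_neqE_nat not_less_iff_gr_or_eq)+
qed

section \<open>Bijection between ternary trees and words\<close>

lemma word_in_words: "word k t \<in> words k (size t)"
proof -
  have "triple_wrt admissible (word k t)"
  proof (induction t arbitrary: k)
    case (Node a b c)
    show ?case
      unfolding word.simps by (rule triple_wrt_admissible_glue) (auto simp: Node set_word)
  qed simp
  then show ?thesis by (simp add: words_def mset_word)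
qed

text \<open>The two copies of \<open>k + 1\<close> cut the word uniquely into three parts. The
  lengths of the last two give the sizes of \<open>b\<close> and \<open>c\<close>, which align the
  offsets for the induction hypothesis.\<close>

lemma word_inject: "word k t = word k u \<Longrightarrow> t = u"
proof (induction t arbitrary: k u)
  case Leaf
  then show ?case by (cases u) auto
next
  case (Node a b c)
  then obtain a' b' c' where u: "u = Node a' b' c'" by (cases u) auto
  have notin: "k + 1 \<notin> set (word (k + 1 + l) t)" for l t
    by (simp add: set_word)
  have split: "xs = xs' \<and> ys = ys'"
    if "x \<notin> set xs" "x \<notin> set xs'" "xs @ x # ys = xs' @ x # ys'" for x :: nat and xs ys xs' ys'
    using that by (auto simp: append_eq_append_conv2 append_eq_Cons_conv Cons_eq_append_conv)
  note eq = Node.prems[unfolded u word.simps]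
  have A: "word (k + 1 + size c + size b) a = word (k + 1 + size c' + size b') a'"
    and 1: "word (k + 1 + size c) b @ (k + 1) # word (k + 1) c =
          word (k + 1 + size c') b' @ (k + 1) # word (k + 1) c'"
    using split[OF _ _ eq] notin by (simp_all add: add.assoc)
  have B: "word (k + 1 + size c) b = word (k + 1 + size c') b'"
    and C: "word (k + 1) c = word (k + 1) c'"
    using split[OF _ _ 1] notin by (simp_all add: add.assoc)
  have "size c = size c'" "size b = size b'"
    using arg_cong[OF B, of length] arg_cong[OF C, of length] by (simp_all add: length_word)
  then show ?case
    using Node.IH A B C u by auto
qed

text \<open>Cutting at the two least letters and applying \<open>twice_split\<close> twice, first to
  separate \<open>A\<close> and then \<open>B\<close> from \<open>C\<close>, gives three shorter
  words over blocks of letters.\<close>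

lemma word_surj: "\<sigma> \<in> words k n \<Longrightarrow> \<exists>t. size t = n \<and> word k t = \<sigma>"
proof (induction n arbitrary: k \<sigma> rule: less_induct)
  case (less n)
  show ?case
  proof (cases n)
    case 0
    then show ?thesis using less.prems by (intro exI[of _ Leaf]) (auto simp: words_def)
  next
    case (Suc n')
    let ?m = "k + 1"
    have ms: "mset \<sigma> = {#?m, ?m#} + twice ?m n'" and tr: "triple_wrt admissible \<sigma>"
      using less.prems Suc by (auto simp: words_def twice_Suc)
    have "?m \<in># mset \<sigma>" using ms by simp
    then obtain A \<tau> where A: "\<sigma> = A @ ?m # \<tau>" "?m \<notin> set A"
      by (metis set_mset_mset split_list_first)
    have ms2: "mset A + mset \<tau> = {#?m#} + twice ?m n'"
      using ms A by simp
    have "?m \<in># mset A + mset \<tau>" unfolding ms2 by simp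
    then have "?m \<in> set \<tau>" using A(2) by simp
    then obtain B C where B: "\<tau> = B @ ?m # C"
      by (metis split_list)
    have ms3: "mset A + (mset B + mset C) = twice ?m n'"
      using ms2 B by simp
    have "\<forall>x\<in>#mset A + (mset B + mset C). ?m < x"
      unfolding ms3 by simp
    then have gt: "\<forall>x\<in>set A. ?m < x" "\<forall>x\<in>set B. ?m < x" "\<forall>x\<in>set C. ?m < x"
      by auto
    note un = triple_wrt_admissible_unglue[OF tr[unfolded A(1) B] gt]
    obtain bc a where a: "n' = bc + a" "mset B + mset C = twice ?m bc" "mset A = twice (?m + bc) a"
      by (rule twice_split[OF ms3]) (use un(4) in auto)
    obtain c b where b: "bc = c + b" "mset C = twice ?m c" "mset B = twice (?m + c) b"
      by (rule twice_split[OF a(2)]) (use un(5) in auto)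
    have "A \<in> words (?m + bc) a" "B \<in> words (?m + c) b" "C \<in> words ?m c"
      using a b un by (auto simp: words_def)
    moreover have "a < n" "b < n" "c < n" using a b Suc by auto
    ultimately obtain ta tb tc where "size ta = a" "word (?m + bc) ta = A" "size tb = b"
      "word (?m + c) tb = B" "size tc = c" "word ?m tc = C"
      using less.IH by metis
    then show ?thesis
      using a b A B Suc by (intro exI[of _ "Node ta tb tc"]) (auto simp: add.assoc)
  qed
qed

lemma bij_betw_word: "bij_betw (word 0) {t. size t = n} (stirling_avoiding n [2, 1, 3])"
  unfolding stirling_avoiding_eq_words
proof (rule bij_betw_imageI)
  show "inj_on (word 0) {t. size t = n}"
    using word_inject by (auto intro: inj_onI)
  show "word 0 ` {t. size t = n} = words 0 n"
    using word_in_words word_surj by blast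
qed

section \<open>Descents, ascents and plateaus of tree words\<close>

definition adjacent :: "(nat \<Rightarrow> nat \<Rightarrow> bool) \<Rightarrow> nat list \<Rightarrow> nat" where
  "adjacent P xs = card {i. Suc i < length xs \<and> P (xs ! i) (xs ! Suc i)}"

lemma adjacent_simps [simp]:
  "adjacent P [] = 0"
  "adjacent P [x] = 0"
  "adjacent P (x # y # ys) = of_bool (P x y) + adjacent P (y # ys)"
proof -
  show "adjacent P [] = 0" "adjacent P [x] = 0" by (auto simp: adjacent_def)
  let ?S = "{i. Suc i < length (y # ys) \<and> P ((y # ys) ! i) ((y # ys) ! Suc i)}"
  have "{i. Suc i < length (x # y # ys) \<and> P ((x # y # ys) ! i) ((x # y # ys) ! Suc i)} =
    (if P x y then {0} else {}) \<union> Suc ` ?S" (is "?l = ?r")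
  proof (rule set_eqI)
    fix i show "i \<in> ?l \<longleftrightarrow> i \<in> ?r" by (cases i) (auto simp: image_iff)
  qed
  moreover have "finite ?S" by (rule finite_subset[of _ "{..<length (y # ys)}"]) auto
  moreover have "0 \<notin> Suc ` ?S" by auto
  ultimately show "adjacent P (x # y # ys) = of_bool (P x y) + adjacent P (y # ys)"
    unfolding adjacent_def by (simp add: card_image)
qed

lemma adjacent_append:
  "adjacent P (xs @ y # ys) =
     adjacent P xs + of_bool (xs \<noteq> [] \<and> P (last xs) y) + adjacent P (y # ys)"
proof (induction xs)
  case (Cons x xs)
  then show ?case by (cases xs) auto
qed simp

lemma adjacent_Cons:
  "adjacent P (x # xs) = of_bool (xs \<noteq> [] \<and> P x (hd xs)) + adjacent P xs"
  by (cases xs) auto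

lemma word_eq_Nil_iff: "word k t = [] \<longleftrightarrow> t = Leaf"
  by (cases t) auto

lemma hd_last_word:
  assumes "t \<noteq> Leaf"
  shows "k < hd (word k t)" "k < last (word k t)"
  using assms set_word[of k t] hd_in_set[of "word k t"] last_in_set[of "word k t"]
  by (auto simp: word_eq_Nil_iff)

text \<open>This treats \<open>des\<close>, \<open>asc\<close> and \<open>plat\<close> at once, with
  \<open>lt\<close>, \<open>eq\<close> and \<open>gt\<close> as the truth values of
  \<open>P\<close>. As \<open>k + 1\<close> is the least letter, a step into it from a nonempty
  subtree is a descent, a step out of it into one is an ascent, and its copies form a plateau when
  \<open>b\<close> is empty.\<close>

lemma adjacent_word_Node:
  assumes "\<And>x y. x < y \<Longrightarrow> P x y = lt" "\<And>x. P x x = eq" "\<And>x y. x > y \<Longrightarrow> P x y = gt"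
  shows "adjacent P (word k (Node a b c)) =
    adjacent P (word (k + 1 + size c + size b) a) + adjacent P (word (k + 1 + size c) b) +
    adjacent P (word (k + 1) c) + of_bool (a \<noteq> Leaf \<and> gt) +
    of_bool (b = Leaf \<and> eq) + of_bool (b \<noteq> Leaf \<and> lt) + of_bool (b \<noteq> Leaf \<and> gt) +
    of_bool (c \<noteq> Leaf \<and> lt)"
proof -
  have 1: "a \<noteq> Leaf \<Longrightarrow> P (last (word (k + 1 + size c + size b) a)) (k + 1) = gt"
    using hd_last_word(2)[of a "k + 1 + size c + size b"] by (intro assms) auto
  have 2: "b \<noteq> Leaf \<Longrightarrow> P (last (word (k + 1 + size c) b)) (k + 1) = gt"
    using hd_last_word(2)[of b "k + 1 + size c"] by (intro assms) auto
  have 3: "b \<noteq> Leaf \<Longrightarrow> P (k + 1) (hd (word (k + 1 + size c) b)) = lt"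
    using hd_last_word(1)[of b "k + 1 + size c"] by (intro assms) auto
  have 4: "c \<noteq> Leaf \<Longrightarrow> P (k + 1) (hd (word (k + 1) c)) = lt"
    using hd_last_word(1)[of c "k + 1"] by (intro assms) auto
  show ?thesis
    using 1 2 3 4 assms(2) unfolding word.simps adjacent_append adjacent_Cons
    by (cases "a = Leaf"; cases "b = Leaf"; cases "c = Leaf")
       (simp_all add: word_eq_Nil_iff adjacent_append hd_append adjacent_Cons)
qed

lemma des_word: "des (word k t) = lefts t + mids t"
proof -
  have "adjacent (>) (word k t) = lefts t + mids t"
    by (induction t arbitrary: k)
      (simp_all add: adjacent_word_Node[where lt = False and eq = False and gt = True] del: word.simps(2))
  then show ?thesis by (simp add: des_def adjacent_def)
qed

lemma asc_word: "asc (word k t) = mids t + rights t"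
proof -
  have "adjacent (<) (word k t) = mids t + rights t"
    by (induction t arbitrary: k)
      (simp_all add: adjacent_word_Node[where lt = True and eq = False and gt = False] del: word.simps(2))
  then show ?thesis by (simp add: asc_def adjacent_def)
qed

text \<open>A node yields a plateau exactly when it has no middle child; the additive form avoids
  subtraction.\<close>

lemma plat_word: "plat (word k t) + mids t = size t"
proof -
  have "adjacent (=) (word k t) + mids t = size t"
  proof (induction t arbitrary: k)
    case (Node a b c)
    have "adjacent (=) (word (k + 1 + size c + size b) a) + mids a = size a"
      "adjacent (=) (word (k + 1 + size c) b) + mids b = size b"
      "adjacent (=) (word (k + 1) c) + mids c = size c"
      by (fact Node)+
    then show ?case
      using adjacent_word_Node[of "(=)" False True False k a b c]
      by (cases "b = Leaf") (simp_all del: word.simps(2))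
  qed simp
  then show ?thesis by (simp add: plat_def adjacent_def)
qed

section \<open>Joint distribution of ascents, descents and plateaus\<close>

abbreviation choose3 :: "nat \<Rightarrow> nat \<Rightarrow> nat \<Rightarrow> nat \<Rightarrow> rat" where
  "choose3 n x y z \<equiv> rat_of_nat (n choose x) * rat_of_nat (n choose y) * rat_of_nat (n choose z) / rat_of_nat n"

text \<open>With \<open>n - 1\<close> edges a forest is a single tree, and the factor
  \<open>n - i - j - k\<close> in \<open>card_forests\<close> is 1.\<close>

lemma card_trees:
  assumes "n \<ge> 1" "i + j + k = n - 1"
  shows "rat_of_nat (card {t. size t = n \<and> lefts t = i \<and> mids t = j \<and> rights t = k}) = choose3 n i j k"
proof -
  have "bij_betw (\<lambda>t. [t]) {t. size t = n \<and> lefts t = i \<and> mids t = j \<and> rights t = k} (forests n i j k)"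
  proof (rule bij_betw_imageI)
    show "(\<lambda>t. [t]) ` {t. size t = n \<and> lefts t = i \<and> mids t = j \<and> rights t = k} = forests n i j k"
    proof (intro equalityI subsetI)
      fix ts assume ts: "ts \<in> forests n i j k"
      then have "length ts = 1"
        using length_forest[of ts] assms by (auto simp: forests_def)
      then obtain t where "ts = [t]" by (metis One_nat_def length_0_conv length_Suc_conv)
      with ts show "ts \<in> (\<lambda>t. [t]) ` {t. size t = n \<and> lefts t = i \<and> mids t = j \<and> rights t = k}"
        by (auto simp: forests_def)
    qed (use assms in \<open>auto simp: forests_def\<close>)
  qed (auto intro: inj_onI)
  then have "card {t. size t = n \<and> lefts t = i \<and> mids t = j \<and> rights t = k} = card (forests n i j k)"
    by (rule bij_betw_same_card)
  moreover have "n - i - j - k = 1" using assms by simp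
  ultimately show ?thesis
    using card_forests[of n i j k] assms by simp
qed

lemma stirling_avoiding_stats:
  assumes "\<sigma> \<in> stirling_avoiding n [2, 1, 3]" "n \<ge> 1"
  shows "asc \<sigma> + des \<sigma> + plat \<sigma> = 2 * n - 1" "asc \<sigma> < n" "des \<sigma> < n" "plat \<sigma> \<le> n"
proof -
  obtain t where t: "size t = n" "\<sigma> = word 0 t"
    using assms(1) bij_betw_word[of n] by (auto simp: bij_betw_def)
  then have "t \<noteq> Leaf" using assms(2) by auto
  then show "asc \<sigma> + des \<sigma> + plat \<sigma> = 2 * n - 1" "asc \<sigma> < n" "des \<sigma> < n" "plat \<sigma> \<le> n"
    using t size_eq_edges[of t] plat_word[of 0 t] by (simp_all add: des_word asc_word)
qed

text \<open>The statistics determine the tree's edge numbers: ascents count the edges that are not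
  left, descents those that are not right, plateaus the nodes without a middle child. Symmetry of
  binomial coefficients does the rest.\<close>

lemma card_stirling_avoiding_stats:
  assumes n: "n \<ge> 1"
  shows "rat_of_nat (card {\<sigma> \<in> stirling_avoiding n [2, 1, 3]. asc \<sigma> = m \<and> des \<sigma> = d \<and> plat \<sigma> = k}) =
    (if 2 * n - 1 = m + d + k then choose3 n (m + 1) (d + 1) k else 0)"
proof (cases "2 * n - 1 = m + d + k \<and> m < n \<and> d < n \<and> k \<le> n")
  case True
  have "{\<sigma> \<in> stirling_avoiding n [2, 1, 3]. asc \<sigma> = m \<and> des \<sigma> = d \<and> plat \<sigma> = k} =
    word 0 ` {t. size t = n \<and> asc (word 0 t) = m \<and> des (word 0 t) = d \<and> plat (word 0 t) = k}"
    using bij_betw_word[of n] by (auto simp: bij_betw_def)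
  also have "{t. size t = n \<and> asc (word 0 t) = m \<and> des (word 0 t) = d \<and> plat (word 0 t) = k} =
    {t. size t = n \<and> lefts t = n - (m + 1) \<and> mids t = n - k \<and> rights t = n - (d + 1)}" (is "?T = ?U")
  proof (intro set_eqI)
    fix t
    show "t \<in> ?T \<longleftrightarrow> t \<in> ?U"
    proof (cases "size t = n")
      case size: True
      then have "t \<noteq> Leaf" using n by auto
      then show ?thesis
        using True size size_eq_edges[of t] plat_word[of 0 t] by (auto simp: des_word asc_word)
    qed auto
  qed
  finally have "card {\<sigma> \<in> stirling_avoiding n [2, 1, 3]. asc \<sigma> = m \<and> des \<sigma> = d \<and> plat \<sigma> = k} = card ?U"
    using word_inject by (simp add: card_image inj_on_def)
  also have "rat_of_nat \<dots> = choose3 n (n - (m + 1)) (n - k) (n - (d + 1))"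
    using True n by (intro card_trees) auto
  also have "\<dots> = choose3 n (m + 1) (d + 1) k"
    using True binomial_symmetric[of "m + 1" n] binomial_symmetric[of "d + 1" n] binomial_symmetric[of k n]
    by simp
  finally show ?thesis using True by simp
next
  case False
  then have "{\<sigma> \<in> stirling_avoiding n [2, 1, 3]. asc \<sigma> = m \<and> des \<sigma> = d \<and> plat \<sigma> = k} = {}"
  proof -
    have "\<not> (asc \<sigma> = m \<and> des \<sigma> = d \<and> plat \<sigma> = k)" if "\<sigma> \<in> stirling_avoiding n [2, 1, 3]" for \<sigma>
      using stirling_avoiding_stats[OF that n] False by (metis add.assoc)
    then show ?thesis by blast
  qed
  \<comment> \<open>Here \<open>m + 1\<close>, \<open>d + 1\<close> or \<open>k\<close> exceeds
    \<open>n\<close>, so a binomial coefficient vanishes.\<close>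
  moreover have "choose3 n (m + 1) (d + 1) k = 0" if "2 * n - 1 = m + d + k"
    using that False by (auto simp: binomial_eq_0)
  ultimately show ?thesis by (simp only: card.empty of_nat_0 if_cancel if_split) simp
qed

section \<open>Distribution of plateaus\<close>

lemma finite_stirling_avoiding: "finite (stirling_avoiding n [2, 1, 3])"
proof -
  have "finite {t :: ttree. size t = n}"
    using finite_size_le[of n] by (rule rev_finite_subset) auto
  then show ?thesis
    using bij_betw_finite[OF bij_betw_word] by blast
qed

text \<open>For \<open>k\<close> plateaus, ascents and descents total
  \<open>N = 2 * n - 1 - k\<close>; summing the joint distribution over them is a Vandermonde
  convolution.\<close>

lemma card_stirling_avoiding_plat:
  assumes n: "n \<ge> 1" and k: "k \<le> n"
  shows "rat_of_nat (card {\<sigma> \<in> stirling_avoiding n [2, 1, 3]. plat \<sigma> = k}) =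
    rat_of_nat (n choose k) * rat_of_nat ((2 * n) choose (2 * n + 1 - k)) / rat_of_nat n"
proof -
  let ?S = "\<lambda>m d. {\<sigma> \<in> stirling_avoiding n [2, 1, 3]. asc \<sigma> = m \<and> des \<sigma> = d \<and> plat \<sigma> = k}"
  define N where "N = 2 * n - 1 - k"
  have Un: "{\<sigma> \<in> stirling_avoiding n [2, 1, 3]. plat \<sigma> = k} = (\<Union>m\<le>N. ?S m (N - m))"
  proof (intro equalityI subsetI)
    fix \<sigma> assume \<sigma>: "\<sigma> \<in> {\<sigma> \<in> stirling_avoiding n [2, 1, 3]. plat \<sigma> = k}"
    then have "asc \<sigma> \<le> N" "des \<sigma> = N - asc \<sigma>"
      using stirling_avoiding_stats(1)[of \<sigma> n] n by (auto simp: N_def)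
    with \<sigma> show "\<sigma> \<in> (\<Union>m\<le>N. ?S m (N - m))" by blast
  qed auto
  have "card {\<sigma> \<in> stirling_avoiding n [2, 1, 3]. plat \<sigma> = k} = (\<Sum>m\<le>N. card (?S m (N - m)))"
    unfolding Un by (rule card_UN_disjoint) (auto simp: finite_stirling_avoiding[simplified])
  then have "rat_of_nat (card {\<sigma> \<in> stirling_avoiding n [2, 1, 3]. plat \<sigma> = k}) =
      (\<Sum>m\<le>N. rat_of_nat (card (?S m (N - m))))"
    by (simp only: of_nat_sum)
  also have "\<dots> = (\<Sum>m\<le>N. choose3 n (Suc m) (Suc (N - m)) k)"
  proof (intro sum.cong refl)
    fix m assume "m \<in> {..N}"
    then have "2 * n - 1 = m + (N - m) + k" using n k by (simp add: N_def)
    then show "rat_of_nat (card (?S m (N - m))) = choose3 n (Suc m) (Suc (N - m)) k"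
      using card_stirling_avoiding_stats[OF n, of m "N - m" k] by (simp only: if_True Suc_eq_plus1 refl)
  qed
  also have "\<dots> = (\<Sum>x\<in>{1..Suc N}. choose3 n x (N + 2 - x) k)"
    by (rule sum.reindex_bij_witness[of _ "\<lambda>x. x - 1" Suc]) (auto simp: Suc_diff_le)
  \<comment> \<open>The added terms \<open>x = 0\<close> and \<open>x = N + 2\<close> vanish because
    \<open>N + 2 = 2 * n + 1 - k\<close> exceeds \<open>n\<close>.\<close>
  also have "\<dots> = (\<Sum>x\<le>N + 2. choose3 n x (N + 2 - x) k)"
  proof (rule sum.mono_neutral_left)
    show "\<forall>x\<in>{..N + 2} - {1..Suc N}. choose3 n x (N + 2 - x) k = 0"
    proof
      fix x assume "x \<in> {..N + 2} - {1..Suc N}"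
      then have "x = 0 \<or> x = N + 2" by auto
      moreover have "n choose (N + 2) = 0" using n k by (intro binomial_eq_0) (auto simp: N_def)
      ultimately show "choose3 n x (N + 2 - x) k = 0" by auto
    qed
  qed auto
  also have "\<dots> = rat_of_nat (\<Sum>x\<le>N + 2. (n choose x) * (n choose (N + 2 - x))) * rat_of_nat (n choose k) / rat_of_nat n"
    by (simp only: sum_divide_distrib sum_distrib_right of_nat_sum of_nat_mult)
  also have "(\<Sum>x\<le>N + 2. (n choose x) * (n choose (N + 2 - x))) = (2 * n) choose (2 * n + 1 - k)"
  proof -
    have "N + 2 = 2 * n + 1 - k" using n k by (simp add: N_def)
    then show ?thesis by (simp only: vandermonde mult_2)
  qed
  finally show ?thesis by (simp add: mult.commute)
qed

text \<open>Words are grouped by their \<open>k = n - i\<close> plateaus, so \<open>i\<close> is the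
  number of middle edges of the tree; binomial symmetry turns \<open>n + 1 + i\<close> into
  \<open>n - 1 - i\<close>.\<close>

lemma sum_plat:
  assumes n: "n \<ge> 1"
  shows "(\<Sum>\<sigma>\<in>stirling_avoiding n [2, 1, 3]. monom 1 1 ^ plat \<sigma>) =
    smult (1 / rat_of_nat n)
      (\<Sum>i=0..n-1. of_nat (n choose i) * of_nat ((2 * n) choose (n - 1 - i)) * monom 1 1 ^ (n - i))"
proof -
  let ?p = "monom 1 1 :: rat poly"
  let ?b = "\<lambda>i. 1 / rat_of_nat n * rat_of_nat (n choose i) * rat_of_nat ((2 * n) choose (n + 1 + i))"
  let ?S = "\<lambda>k. {\<sigma> \<in> stirling_avoiding n [2, 1, 3]. plat \<sigma> = k}"
  have "(\<Sum>\<sigma>\<in>stirling_avoiding n [2, 1, 3]. ?p ^ plat \<sigma>) = (\<Sum>k\<le>n. \<Sum>\<sigma>\<in>?S k. ?p ^ plat \<sigma>)"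
    using stirling_avoiding_stats(4) n
    by (intro sum.group[symmetric] finite_stirling_avoiding) auto
  also have "\<dots> = (\<Sum>k\<le>n. smult (rat_of_nat (card (?S k))) (?p ^ k))"
  proof (intro sum.cong refl)
    fix k
    have "(\<Sum>\<sigma>\<in>?S k. ?p ^ plat \<sigma>) = (\<Sum>\<sigma>\<in>?S k. ?p ^ k)" by (intro sum.cong) auto
    then show "(\<Sum>\<sigma>\<in>?S k. ?p ^ plat \<sigma>) = smult (rat_of_nat (card (?S k))) (?p ^ k)"
      by (simp add: of_nat_poly)
  qed
  also have "\<dots> = (\<Sum>i\<le>n. smult (rat_of_nat (card (?S (n - i)))) (?p ^ (n - i)))"
    by (rule sum.reindex_bij_witness[of _ "\<lambda>i. n - i" "\<lambda>i. n - i"]) auto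
  also have "\<dots> = (\<Sum>i\<le>n. smult (?b i) (?p ^ (n - i)))"
  proof (intro sum.cong refl)
    fix i assume i: "i \<in> {..n}"
    then have "2 * n + 1 - (n - i) = n + 1 + i" by auto
    then have "rat_of_nat (card (?S (n - i))) = ?b i"
      using card_stirling_avoiding_plat[OF n, of "n - i"] i binomial_symmetric[of i n] by simp
    then show "smult (rat_of_nat (card (?S (n - i)))) (?p ^ (n - i)) =
      smult (?b i) (?p ^ (n - i))"
      by simp
  qed
  \<comment> \<open>The term \<open>i = n\<close> carries the factor
    \<open>(2 * n) choose (2 * n + 1)\<close>, which is zero: every word has a plateau.\<close>
  also have "\<dots> = (\<Sum>i=0..n-1. smult (?b i) (?p ^ (n - i)))"
  proof (rule sum.mono_neutral_right)
    show "\<forall>i\<in>{..n} - {0..n - 1}. smult (?b i) (?p ^ (n - i)) = 0"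
      by (auto simp: not_le intro!: binomial_eq_0)
  qed auto
  also have "\<dots> = (\<Sum>i=0..n-1. smult (1 / rat_of_nat n) (of_nat (n choose i) * of_nat ((2 * n) choose (n - 1 - i)) * ?p ^ (n - i)))"
  proof (intro sum.cong refl)
    fix i assume "i \<in> {0..n - 1}"
    then have "(2 * n) choose (n + 1 + i) = (2 * n) choose (n - 1 - i)"
      using n binomial_symmetric[of "n + 1 + i" "2 * n"] by simp
    then show "smult (?b i) (?p ^ (n - i)) =
      smult (1 / rat_of_nat n) (of_nat (n choose i) * of_nat ((2 * n) choose (n - 1 - i)) * ?p ^ (n - i))"
      by (simp add: of_nat_poly mult_ac)
  qed
  also have "\<dots> = smult (1 / rat_of_nat n)
      (\<Sum>i=0..n-1. of_nat (n choose i) * of_nat ((2 * n) choose (n - 1 - i)) * ?p ^ (n - i))"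
    by (rule sum_comp_morphism[unfolded o_def]) (simp_all add: smult_add_right)
  finally show ?thesis .
qed

section \<open>Symmetry of the weighted polynomial\<close>

definition expo :: "nat \<Rightarrow> nat \<Rightarrow> nat \<Rightarrow> (nat \<Rightarrow>\<^sub>0 nat)" where
  "expo a b c = Poly_Mapping.single 0 a + Poly_Mapping.single 1 b + Poly_Mapping.single 2 c"

lemma lookup_expo:
  "Poly_Mapping.lookup (expo a b c) x = (if x = 0 then a else if x = 1 then b else if x = 2 then c else 0)"
  by (simp add: expo_def lookup_add lookup_single when_def)

lemma mvar_power: "mvar i ^ e = Poly_Mapping.single (Poly_Mapping.single i e) 1"
proof (induction e)
  case (Suc e)
  then show ?case
    by (simp add: mvar_def mult_single flip: single_add)
qed simp

text \<open>Each word contributes one monomial; the factor \<open>mvar 1 * mvar 2\<close> raises the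
  exponents of \<open>q\<close> and \<open>r\<close> by one.\<close>

lemma lookup_weighted_enum:
  "Poly_Mapping.lookup (mvar 1 * mvar 2 * stirling_enum n [2, 1, 3] (mvar 0) (mvar 1) (mvar 2)) e =
     int (card {\<sigma> \<in> stirling_avoiding n [2, 1, 3]. expo (plat \<sigma>) (des \<sigma> + 1) (asc \<sigma> + 1) = e})"
proof -
  have "mvar 1 * mvar 2 * (mvar 0 ^ k * mvar 1 ^ d * mvar 2 ^ m) =
      Poly_Mapping.single (expo k (d + 1) (m + 1)) 1" for k d m
  proof -
    have "mvar 1 * mvar 2 * (mvar 0 ^ k * mvar 1 ^ d * mvar 2 ^ m) =
      mvar 0 ^ k * mvar 1 ^ (d + 1) * mvar 2 ^ (m + 1)"
      by (simp add: mult_ac)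
    then show ?thesis unfolding mvar_power by (simp add: mult_single expo_def)
  qed
  then have "mvar 1 * mvar 2 * stirling_enum n [2, 1, 3] (mvar 0) (mvar 1) (mvar 2) =
    (\<Sum>\<sigma>\<in>stirling_avoiding n [2, 1, 3]. Poly_Mapping.single (expo (plat \<sigma>) (des \<sigma> + 1) (asc \<sigma> + 1)) 1)"
    unfolding stirling_enum_def sum_distrib_left by (intro sum.cong) simp_all
  then show ?thesis
    using finite_stirling_avoiding
    by (simp add: lookup_sum lookup_single when_def sum.If_cases Int_def eq_commute[of e])
qed

text \<open>The shift by one absorbs the asymmetry of the joint distribution: the three exponents
  now enter alike, with total \<open>2 * n + 1\<close>.\<close>

lemma lookup_weighted_enum_eq:
  assumes n: "n \<ge> 1"
  shows "rat_of_int (Poly_Mapping.lookup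
       (mvar 1 * mvar 2 * stirling_enum n [2, 1, 3] (mvar 0) (mvar 1) (mvar 2)) e) =
     (if (\<forall>x. x \<notin> {0, 1, 2} \<longrightarrow> Poly_Mapping.lookup e x = 0) \<and> (\<Sum>x\<in>{0, 1, 2}. Poly_Mapping.lookup e x) = 2 * n + 1
      then (\<Prod>x\<in>{0, 1, 2}. rat_of_nat (n choose Poly_Mapping.lookup e x)) / rat_of_nat n else 0)"
proof -
  let ?l = "Poly_Mapping.lookup e"
  let ?S = "{\<sigma> \<in> stirling_avoiding n [2, 1, 3]. expo (plat \<sigma>) (des \<sigma> + 1) (asc \<sigma> + 1) = e}"
  have eq: "expo a b c = e \<longleftrightarrow> (\<forall>x. x \<notin> {0, 1, 2} \<longrightarrow> ?l x = 0) \<and> ?l 0 = a \<and> ?l 1 = b \<and> ?l 2 = c" for a b c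
  proof -
    have "expo a b c = e \<longleftrightarrow> (\<forall>x. Poly_Mapping.lookup (expo a b c) x = ?l x)"
      by (metis poly_mapping_eqI)
    also have "\<dots> \<longleftrightarrow> (\<forall>x. x \<notin> {0, 1, 2} \<longrightarrow> ?l x = 0) \<and> ?l 0 = a \<and> ?l 1 = b \<and> ?l 2 = c"
      (is "?L \<longleftrightarrow> ?R")
    proof
      assume ?L
      show ?R
      proof (intro conjI allI impI)
        fix x :: nat assume "x \<notin> {0, 1, 2}"
        then show "?l x = 0" using spec[OF \<open>?L\<close>, of x] by (simp add: lookup_expo)
      qed (use spec[OF \<open>?L\<close>, of 0] spec[OF \<open>?L\<close>, of 1] spec[OF \<open>?L\<close>, of 2] in \<open>simp_all add: lookup_expo\<close>)
    next
      assume ?R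
      then show ?L by (simp add: lookup_expo)
    qed
    finally show ?thesis .
  qed
  show ?thesis
  proof (cases "(\<forall>x. x \<notin> {0, 1, 2} \<longrightarrow> ?l x = 0) \<and> ?l 1 > 0 \<and> ?l 2 > 0")
    case True
    then have "?S = {\<sigma> \<in> stirling_avoiding n [2, 1, 3]. asc \<sigma> = ?l 2 - 1 \<and> des \<sigma> = ?l 1 - 1 \<and> plat \<sigma> = ?l 0}"
      unfolding eq by auto
    moreover have "2 * n - 1 = ?l 2 - 1 + (?l 1 - 1) + ?l 0 \<longleftrightarrow> ?l 0 + ?l 1 + ?l 2 = 2 * n + 1"
      using True n by linarith
    moreover have "?l 1 - 1 + 1 = ?l 1" "?l 2 - 1 + 1 = ?l 2" using True by simp_all
    ultimately have "rat_of_nat (card ?S) = (if ?l 0 + ?l 1 + ?l 2 = 2 * n + 1 then choose3 n (?l 2) (?l 1) (?l 0) else 0)"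
      using card_stirling_avoiding_stats[OF n, of "?l 2 - 1" "?l 1 - 1" "?l 0"] by (simp only:)
    then show ?thesis
      using True unfolding lookup_weighted_enum by (simp add: add.assoc mult_ac)
  next
    case False
    then have "?S = {}" unfolding eq by auto
    then have "rat_of_int (int (card ?S)) = 0" by (simp only: card.empty of_nat_0 of_int_0)
    moreover have "(\<Prod>x\<in>{0, 1, 2}. rat_of_nat (n choose ?l x)) = 0"
      if *: "\<forall>x. x \<notin> {0, 1, 2} \<longrightarrow> ?l x = 0" "(\<Sum>x\<in>{0, 1, 2}. ?l x) = 2 * n + 1"
    proof -
      \<comment> \<open>No word gives such an exponent. The formula agrees: the other two exponents
        sum to \<open>2 * n + 1\<close>, so one exceeds \<open>n\<close>.\<close>
      have "?l 1 = 0 \<or> ?l 2 = 0" using False *(1) by auto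
      then have "?l 0 > n \<or> ?l 1 > n \<or> ?l 2 > n" using *(2) by auto
      then show ?thesis by (auto simp: binomial_eq_0)
    qed
    ultimately show ?thesis
      unfolding lookup_weighted_enum by (metis (no_types, lifting) div_0)
  qed
qed

text \<open>The total, the product and the vanishing outside \<open>{0, 1, 2}\<close> in the
  coefficient formula are all invariant under a permutation of \<open>{0, 1, 2}\<close>.\<close>

lemma symmetric_weighted_enum:
  assumes "n \<ge> 1"
  shows "symmetric_in {0, 1, 2} (mvar 1 * mvar 2 * stirling_enum n [2, 1, 3] (mvar 0) (mvar 1) (mvar 2))"
  unfolding symmetric_in_def
proof (intro allI impI)
  fix \<pi> :: "nat \<Rightarrow> nat" and e :: "nat \<Rightarrow>\<^sub>0 nat"
  assume \<pi>: "\<pi> permutes {0, 1, 2}"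
  let ?f = "mvar 1 * mvar 2 * stirling_enum n [2, 1, 3] (mvar 0) (mvar 1) (mvar 2) :: int_mpoly"
  let ?V = "{0, 1, 2} :: nat set"
  have l: "Poly_Mapping.lookup (Poly_Mapping.map_key \<pi> e) x = Poly_Mapping.lookup e (\<pi> x)" for x
    using permutes_inj[OF \<pi>] by (simp add: map_key.rep_eq)
  have "(\<Sum>x\<in>?V. Poly_Mapping.lookup e (\<pi> x)) = (\<Sum>x\<in>?V. Poly_Mapping.lookup e x)"
    using sum.permute[OF \<pi>, of "Poly_Mapping.lookup e"] by (simp only: o_def)
  moreover have "(\<Prod>x\<in>?V. rat_of_nat (n choose Poly_Mapping.lookup e (\<pi> x))) =
      (\<Prod>x\<in>?V. rat_of_nat (n choose Poly_Mapping.lookup e x))"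
    using prod.permute[OF \<pi>, of "\<lambda>x. rat_of_nat (n choose Poly_Mapping.lookup e x)"] by (simp only: o_def)
  moreover have "(\<forall>x. x \<notin> ?V \<longrightarrow> Poly_Mapping.lookup e (\<pi> x) = 0) \<longleftrightarrow> (\<forall>x. x \<notin> ?V \<longrightarrow> Poly_Mapping.lookup e x = 0)"
    using permutes_not_in[OF \<pi>] by metis
  ultimately have "rat_of_int (Poly_Mapping.lookup ?f (Poly_Mapping.map_key \<pi> e)) =
    rat_of_int (Poly_Mapping.lookup ?f e)"
    unfolding lookup_weighted_enum_eq[OF assms] l by (simp only:)
  then show "Poly_Mapping.lookup ?f (Poly_Mapping.map_key \<pi> e) =
    Poly_Mapping.lookup ?f e"
    by (simp only: of_int_eq_iff)
qed

theorem theorem1p1: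
  fixes n :: nat
  assumes "n \<ge> 1"
  shows "(let p = mvar 0; q = mvar 1; r = mvar 2
          in symmetric_in {0, 1, 2} (q * r * stirling_enum n [2, 1, 3] p q r)) \<and>
    (\<forall>m d k :: nat.
       rat_of_nat (card {\<sigma> \<in> stirling_avoiding n [2, 1, 3]. asc \<sigma> = m \<and> des \<sigma> = d \<and> plat \<sigma> = k}) =
         (if 2 * n - 1 = m + d + k
          then 1 / rat_of_nat n * rat_of_nat (n choose (m + 1)) * rat_of_nat (n choose (d + 1))
                 * rat_of_nat (n choose k)
          else 0)) \<and>
    (let p = monom 1 1 :: rat poly
     in (\<Sum>\<sigma>\<in>stirling_avoiding n [2, 1, 3]. p ^ plat \<sigma>) =
        smult (1 / rat_of_nat n)
          (\<Sum>i=0..n-1. of_nat (n choose i) * of_nat ((2 * n) choose (n - 1 - i)) * p ^ (n - i)))"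
  unfolding Let_def card_stirling_avoiding_stats[OF assms] sum_plat[OF assms]
  using symmetric_weighted_enum[OF assms] by simp

end
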